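(* Let $W$ denote the principal branch of the Lambert $W$ function on the positive reals. Then for every integer $n\ge 1$ and every $x>0$, $(-1)^{n-1}\dfrac{d^{n-1}}{dx^{n-1}}\left(\dfrac{dW}{dx}\right)(x)>0$. Consequently the derivative $W'$ is completely monotonic on $(0,\infty)$, and $W$ is a Bernstein function.
   Context: For $x>0$, $W(x)$ is the unique positive real number $w$ with $w e^{w}=x$. A function $g:(0,\infty)\to\mathbb{R}$ is completely monotonic if it is infinitely differentiable and $(-1)^m g^{(m)}(x)\ge 0$ for all integers $m\ge 0$ and all $x>0$. A function $f:(0,\infty)\to[0,\infty)$ is a Bernstein function if it is infinitely differentiable and $f'$ is completely monotonic. *)

theory Defs
  imports "HOL-Analysis.Analysis"
begin

(* Only the values at x > 0 are meaningful; see lambert_W_ex1 for well-definedness there. *)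
definition lambert_W :: "real \<Rightarrow> real" where
  "lambert_W x = (THE w. 0 < w \<and> w * exp w = x)"

lemma lambert_W_ex1:
  fixes x :: real
  assumes "0 < x"
  shows "\<exists>!w. 0 < w \<and> w * exp w = x"
proof (rule ex_ex1I)
  have "\<exists>w\<ge>0. w \<le> x \<and> w * exp w = x"
  proof (rule IVT')
    show "0 * exp 0 \<le> x" using assms by simp
    show "x \<le> x * exp x" using assms by simp
    show "0 \<le> x" using assms by simp
    show "continuous_on {0..x} (\<lambda>w. w * exp w)" by (intro continuous_intros)
  qed
  then obtain w where "w \<ge> 0" "w * exp w = x" by blast
  moreover from this assms have "w \<noteq> 0" by auto
  ultimately show "\<exists>w. 0 < w \<and> w * exp w = x" by (intro exI[of _ w]) auto
next
  have mono: "a * exp a < b * exp b" if "0 < a" "a < b" for a b :: real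
    using that by (intro mult_strict_mono) auto
  fix v w :: real
  assume "0 < v \<and> v * exp v = x" "0 < w \<and> w * exp w = x"
  then show "v = w" using mono[of v w] mono[of w v] by (cases v w rule: linorder_cases) auto
qed

(* A function on (0, oo) is represented by a total function real \<Rightarrow> real. As (0, oo) is open,
   its iterated derivatives at points x > 0 do not depend on the values outside (0, oo).
   Since deriv is a choice operator, differentiability is always required explicitly. *)
definition infinitely_differentiable_pos :: "(real \<Rightarrow> real) \<Rightarrow> bool" where
  "infinitely_differentiable_pos f \<longleftrightarrow> (\<forall>k. \<forall>x>0. (deriv ^^ k) f differentiable (at x))"

definition completely_monotonic :: "(real \<Rightarrow> real) \<Rightarrow> bool" where
  "completely_monotonic g \<longleftrightarrow>
     infinitely_differentiable_pos g \<and> (\<forall>m. \<forall>x>0. (-1) ^ m * (deriv ^^ m) g x \<ge> 0)"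

definition bernstein_function :: "(real \<Rightarrow> real) \<Rightarrow> bool" where
  "bernstein_function f \<longleftrightarrow>
     (\<forall>x>0. f x \<ge> 0) \<and> infinitely_differentiable_pos f \<and> completely_monotonic (deriv f)"

end

theory Submission
  imports Defs
begin

text \<open>
  Differentiating \<open>w * exp w = x\<close> shows that \<open>W = lambert_W\<close> solves the autonomous
  equation \<open>W' = h \<circ> W\<close> with \<open>h w = exp (- w) / (1 + w)\<close>. By the chain rule
  \<open>(F \<circ> W)' = - (T F \<circ> W)\<close> with \<open>T F = - F' * h\<close>, so that
  \<open>(- 1) ^ n\<close> times the \<open>n\<close>-th derivative of \<open>W'\<close> is \<open>(T ^^ n) h \<circ> W\<close>. It is therefore
  enough to have a class of functions that contains \<open>h\<close>, consists of functions positive on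
  \<open>(0, \<infinity>)\<close> and is mapped into itself by \<open>T\<close>. The positive combinations of
  the functions \<open>exp (- j * w) / (1 + w) ^ k\<close> with \<open>j, k > 0\<close> form such a class
  (lemma \<open>exp_recip_cone_step\<close>), because \<open>T\<close> maps this generator to \<open>j\<close> times the one with
  exponents \<open>j + 1, k + 1\<close> plus \<open>k\<close> times the one with exponents \<open>j + 1, k + 2\<close>.
\<close>

lemma lambert_W_pos: "0 < x \<Longrightarrow> 0 < lambert_W x"
  and lambert_W_eq: "0 < x \<Longrightarrow> lambert_W x * exp (lambert_W x) = x"
  using theI'[OF lambert_W_ex1, of x] unfolding lambert_W_def by auto

lemma lambert_W_mult_exp: "0 < w \<Longrightarrow> lambert_W (w * exp w) = w"
  unfolding lambert_W_def by (rule the1_equality[OF lambert_W_ex1]) simp_all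

lemma has_real_derivative_lambert_W:
  assumes "0 < x"
  shows "(lambert_W has_real_derivative exp (- lambert_W x) / (1 + lambert_W x)) (at x)"
proof -
  define w where "w = lambert_W x"
  have w: "0 < w" "w * exp w = x"
    using assms by (simp_all add: w_def lambert_W_pos lambert_W_eq)
  define D where "D = exp w * (1 + w)"
  have "D \<noteq> 0"
    using w(1) by (simp add: D_def)
  have "((\<lambda>w. w * exp w) has_derivative (*) D) (at w)"
    unfolding has_field_derivative_def[symmetric] D_def
    by (auto intro!: derivative_eq_intros simp: algebra_simps)
  moreover have "continuous_on {0<..} (\<lambda>w::real. w * exp w)"
    by (intro continuous_intros)
  moreover have "(*) D \<circ> (*) (inverse D) = id"
    using \<open>D \<noteq> 0\<close> by (auto simp: fun_eq_iff)
  ultimately have "(lambert_W has_derivative (*) (inverse D)) (at (w * exp w))"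
    using w(1)
    by (intro has_derivative_inverse_strong[where S = "{0<..}" and f = "\<lambda>w. w * exp w"])
       (auto simp: lambert_W_mult_exp)
  then show ?thesis
    unfolding has_field_derivative_def
    using w(2) by (simp add: D_def w_def exp_minus divide_inverse)
qed

inductive exp_recip_cone :: "(real \<Rightarrow> real) \<Rightarrow> bool" where
  generator: "0 < j \<Longrightarrow> 0 < k \<Longrightarrow> exp_recip_cone (\<lambda>w. exp (- real j * w) / (1 + w) ^ k)"
| add: "exp_recip_cone F \<Longrightarrow> exp_recip_cone G \<Longrightarrow> exp_recip_cone (\<lambda>w. F w + G w)"
| scale: "0 < c \<Longrightarrow> exp_recip_cone F \<Longrightarrow> exp_recip_cone (\<lambda>w. c * F w)"

lemma exp_recip_cone_pos: "exp_recip_cone F \<Longrightarrow> 0 < w \<Longrightarrow> 0 < F w"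
  by (induction rule: exp_recip_cone.induct) (auto intro: add_pos_pos)

text \<open>
  The function \<open>G\<close> is \<open>T F = - F' * h\<close>; dividing by \<open>h\<close> gives the form of \<open>F'\<close> below.
  Since \<open>T\<close> is linear, only the generators need a computation.
\<close>

lemma exp_recip_cone_step:
  assumes "exp_recip_cone F"
  shows "\<exists>G. exp_recip_cone G \<and>
    (\<forall>w>0. (F has_real_derivative - (G w * (exp w * (1 + w)))) (at w))"
  using assms
proof (induction rule: exp_recip_cone.induct)
  case (generator j k)
  define G where "G = (\<lambda>w::real. real j * (exp (- real (Suc j) * w) / (1 + w) ^ Suc k) +
    real k * (exp (- real (Suc j) * w) / (1 + w) ^ Suc (Suc k)))"
  have "exp_recip_cone G"
    unfolding G_def using generator
    by (intro exp_recip_cone.add exp_recip_cone.scale exp_recip_cone.generator) auto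
  moreover have "((\<lambda>w. exp (- real j * w) / (1 + w) ^ k) has_real_derivative
      - (G w * (exp w * (1 + w)))) (at w)" if "0 < w" for w
  proof -
    define E where "E = exp (- real j * w)"
    define q where "q = 1 + w"
    define p where "p = q ^ (k - 1)"
    have nz: "q \<noteq> 0" "p \<noteq> 0"
      using that by (simp_all add: p_def q_def)
    have pow: "q ^ k = q * p"
      using generator(2) by (simp add: p_def flip: power_Suc)
    have expE: "exp (- real (Suc j) * w) = E / exp w"
      by (simp add: E_def algebra_simps flip: exp_diff)
    have "((\<lambda>w. exp (- real j * w)) has_real_derivative - real j * E) (at w)"
      unfolding E_def by (auto intro!: derivative_eq_intros)
    moreover have "((\<lambda>w. (1 + w) ^ k) has_real_derivative real k * p) (at w)"
      unfolding p_def q_def by (auto intro!: derivative_eq_intros)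
    ultimately have "((\<lambda>w. exp (- real j * w) / (1 + w) ^ k) has_real_derivative
        (- real j * E * q ^ k - E * (real k * p)) / (q ^ k * q ^ k)) (at w)"
      using DERIV_divide nz unfolding E_def q_def by fastforce
    also have "(- real j * E * q ^ k - E * (real k * p)) / (q ^ k * q ^ k) =
        - (E * (real j + real k / q) / (q * p))"
      unfolding pow using nz by (simp add: field_simps)
    also have "E * (real j + real k / q) / (q * p) = G w * (exp w * (1 + w))"
      unfolding G_def expE q_def[symmetric] power_Suc pow using nz by (simp add: field_simps)
    finally show ?thesis .
  qed
  ultimately show ?case by blast
next
  case (add F1 F2)
  then obtain G1 G2 where G: "exp_recip_cone G1" "exp_recip_cone G2"
    "\<And>w. 0 < w \<Longrightarrow> (F1 has_real_derivative - (G1 w * (exp w * (1 + w)))) (at w)"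
    "\<And>w. 0 < w \<Longrightarrow> (F2 has_real_derivative - (G2 w * (exp w * (1 + w)))) (at w)"
    by blast
  have "((\<lambda>w. F1 w + F2 w) has_real_derivative
      - ((G1 w + G2 w) * (exp w * (1 + w)))) (at w)" if "0 < w" for w
    using DERIV_add[OF G(3,4)[OF that]] by (simp add: algebra_simps)
  then show ?case
    using exp_recip_cone.add[OF G(1,2)] by blast
next
  case (scale c F)
  then obtain G where G: "exp_recip_cone G"
    "\<And>w. 0 < w \<Longrightarrow> (F has_real_derivative - (G w * (exp w * (1 + w)))) (at w)"
    by blast
  have "((\<lambda>w. c * F w) has_real_derivative - (c * G w * (exp w * (1 + w)))) (at w)"
    if "0 < w" for w
    using DERIV_cmult[OF G(2)[OF that], of c] by (simp add: mult.assoc)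
  then show ?case
    using exp_recip_cone.scale[OF scale(1) G(1)] by blast
qed

text \<open>
  Here \<open>f\<close> is only assumed to agree with \<open>c * F \<circ> W\<close> on the open half-line, because
  iterated derivatives of the total function \<open>lambert_W\<close> are controlled nowhere else.
\<close>

lemma exp_recip_cone_lambert_W_derivative:
  assumes "exp_recip_cone F" and f: "\<And>x. 0 < x \<Longrightarrow> f x = c * F (lambert_W x)"
  shows "\<exists>G. exp_recip_cone G \<and>
    (\<forall>x>0. (f has_real_derivative - c * G (lambert_W x)) (at x))"
proof -
  obtain G where G: "exp_recip_cone G"
    "\<forall>w>0. (F has_real_derivative - (G w * (exp w * (1 + w)))) (at w)"
    using exp_recip_cone_step[OF assms(1)] by blast
  have "(f has_real_derivative - c * G (lambert_W x)) (at x)" if "0 < x" for x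
  proof -
    define w where "w = lambert_W x"
    have "0 < w" using lambert_W_pos[OF that] by (simp add: w_def)
    then have cancel: "- (G w * (exp w * (1 + w))) * (exp (- w) / (1 + w)) = - G w"
      by (simp add: exp_minus divide_simps)
    have "((\<lambda>x. F (lambert_W x)) has_real_derivative
        - (G w * (exp w * (1 + w))) * (exp (- w) / (1 + w))) (at x)"
      using \<open>0 < w\<close> G(2) has_real_derivative_lambert_W[OF that] unfolding w_def
      by (intro DERIV_chain2[where f = F]) auto
    then have "((\<lambda>x. c * F (lambert_W x)) has_real_derivative c * - G w) (at x)"
      unfolding cancel by (rule DERIV_cmult)
    then have "(f has_real_derivative c * - G w) (at x)"
      by (rule has_field_derivative_transform_within_open[where S = "{0<..}"])
         (use that f in auto)
    then show ?thesis by (simp add: w_def)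
  qed
  with G(1) show ?thesis by blast
qed

lemma lambert_W_higher_deriv:
  "\<exists>F. exp_recip_cone F \<and>
    (\<forall>x>0. (deriv ^^ n) (deriv lambert_W) x = (- 1) ^ n * F (lambert_W x))"
proof (induction n)
  case 0
  have "exp_recip_cone (\<lambda>w. exp (- real 1 * w) / (1 + w) ^ 1)"
    by (rule exp_recip_cone.generator) auto
  moreover have "deriv lambert_W x = exp (- real 1 * lambert_W x) / (1 + lambert_W x) ^ 1"
    if "0 < x" for x
    using DERIV_imp_deriv[OF has_real_derivative_lambert_W[OF that]] by simp
  ultimately show ?case
    by (intro exI conjI) auto
next
  case (Suc n)
  then obtain F where "exp_recip_cone F"
    "\<And>x. 0 < x \<Longrightarrow> (deriv ^^ n) (deriv lambert_W) x = (- 1) ^ n * F (lambert_W x)"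
    by blast
  from exp_recip_cone_lambert_W_derivative[OF this] obtain G where G: "exp_recip_cone G"
    "\<And>x. 0 < x \<Longrightarrow> ((deriv ^^ n) (deriv lambert_W) has_real_derivative
      - ((- 1) ^ n) * G (lambert_W x)) (at x)"
    by blast
  have "(deriv ^^ Suc n) (deriv lambert_W) x = (- 1) ^ Suc n * G (lambert_W x)"
    if "0 < x" for x
    using DERIV_imp_deriv[OF G(2)[OF that]] by simp
  with G(1) show ?case by blast
qed

lemma lambert_W_higher_deriv_sign:
  assumes "0 < x"
  shows "0 < (- 1) ^ n * (deriv ^^ n) (deriv lambert_W) x"
proof -
  obtain F where "exp_recip_cone F"
    "(deriv ^^ n) (deriv lambert_W) x = (- 1) ^ n * F (lambert_W x)"
    using lambert_W_higher_deriv assms by blast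
  then show ?thesis
    using exp_recip_cone_pos[OF _ lambert_W_pos[OF assms]]
    by (simp flip: mult.assoc power_mult_distrib)
qed

lemma infinitely_differentiable_pos_deriv_lambert_W:
  "infinitely_differentiable_pos (deriv lambert_W)"
  unfolding infinitely_differentiable_pos_def
proof (intro allI impI)
  fix n and x :: real
  assume "0 < x"
  obtain F where "exp_recip_cone F"
    "\<And>x. 0 < x \<Longrightarrow> (deriv ^^ n) (deriv lambert_W) x = (- 1) ^ n * F (lambert_W x)"
    using lambert_W_higher_deriv by blast
  from exp_recip_cone_lambert_W_derivative[OF this] \<open>0 < x\<close>
  show "(deriv ^^ n) (deriv lambert_W) differentiable (at x)"
    by (auto simp: real_differentiable_def)
qed

lemma infinitely_differentiable_pos_lambert_W: "infinitely_differentiable_pos lambert_W"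
  unfolding infinitely_differentiable_pos_def
proof (intro allI impI)
  fix n and x :: real
  assume "0 < x"
  show "(deriv ^^ n) lambert_W differentiable (at x)"
  proof (cases n)
    case 0
    then show ?thesis
      using has_real_derivative_lambert_W[OF \<open>0 < x\<close>] by (auto simp: real_differentiable_def)
  next
    case (Suc m)
    then show ?thesis
      using infinitely_differentiable_pos_deriv_lambert_W \<open>0 < x\<close>
      by (simp add: infinitely_differentiable_pos_def funpow_Suc_right del: funpow.simps)
  qed
qed

theorem mainTheorem4:
  shows "(\<forall>n::nat. n \<ge> 1 \<longrightarrow>
            (\<forall>x>0. (-1) ^ (n - 1) * (deriv ^^ (n - 1)) (deriv lambert_W) x > 0))
       \<and> completely_monotonic (deriv lambert_W)
       \<and> bernstein_function lambert_W"
proof -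
  have "completely_monotonic (deriv lambert_W)"
    unfolding completely_monotonic_def
    using infinitely_differentiable_pos_deriv_lambert_W
    by (auto intro: less_imp_le[OF lambert_W_higher_deriv_sign])
  then show ?thesis
    using lambert_W_higher_deriv_sign infinitely_differentiable_pos_lambert_W
    by (auto simp: bernstein_function_def intro: less_imp_le[OF lambert_W_pos])
qed

end
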